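(* In the setting below, let $\gamma$ be a proper generalizer. If $\mathrm{GCG}_{\simeq}(\Phi,\psi,\gamma)$ maintains Property 3 (for the generalizer $\gamma$) as an invariant, then it also maintains Property 2.
   Context: LTS setting. A labeled transition system (LTS) is $\langle\Sigma,Q,Q_0,\Delta\rangle$ (finite labels $\Sigma$, finite states $Q$, initial states $Q_0\subseteq Q$, $\Delta\subseteq Q\times\Sigma\times Q$). Fix an LTS $M_0=\langle\Sigma,Q,Q_0,\Delta_0\rangle$; a completion of $M_0$ is an LTS with the same $\Sigma,Q,Q_0$ and a transition relation $\Delta\supseteq\Delta_0$. Let $V=\{x_{p,a,q}: p,q\in Q, a\in\Sigma\}$ be Boolean variables; an assignment $\sigma:V\to\{0,1\}$ encodes the LTS $M_\sigma$ with $\Sigma,Q,Q_0$ and $\Delta_\sigma=\{(p,a,q):\sigma(x_{p,a,q})=1\}$. $\Phi$ is a propositional formula over $V$ that implies $\bigwedge_{(p,a,q)\in\Delta_0}x_{p,a,q}$ (so every satisfying assignment encodes a completion of $M_0$). Let $A$ be the set of non-initial states of $M_0$ with no incoming or outgoing transitions in $\Delta_0$. For assignments $\sigma,\rho$ satisfying $\Phi$, $\sigma\simeq\rho$ means there is a bijection $f:Q\to Q$ with $f(q)=q$ for $q\notin A$ such that $(p,a,q)\in\Delta_\sigma$ iff $(f(p),a,f(q))\in\Delta_\rho$. For $\rho\models\Phi$, $[\rho]=\{\sigma:\sigma\models\Phi,\ \sigma\simeq\rho\}$, also viewed as the formula satisfied exactly by its elements. $\psi$ is a specification with satisfaction relation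 $M\models\psi$, assumed invariant under isomorphism: if $\sigma\simeq\rho$ then $M_\sigma\models\psi$ iff $M_\rho\models\psi$. An assignment is identified with the formula satisfied by exactly it. A generalizer maps assignments to formulas over $V$; $\gamma$ is proper if for every $\sigma\models\Phi$ with $M_\sigma\not\models\psi$: $\sigma\models\gamma(\sigma)$, and no $\rho$ with $\rho\models\Phi$, $M_\rho\models\psi$ satisfies $\gamma(\sigma)$. Algorithm $\mathrm{GCG}_{\simeq}(\Phi,\psi,g)$ for a generalizer $g$: keep $\Phi_{cur}:=\Phi$; while $\Phi_{cur}$ is satisfiable, pick an arbitrary $\sigma\models\Phi_{cur}$ (a candidate); if $M_\sigma\models\psi$, output $\sigma$ (a solution) and set $\Phi_{cur}:=\Phi_{cur}\wedge\neg[\sigma]$; else set $\Phi_{cur}:=\Phi_{cur}\wedge\neg g(\sigma)$. In an execution, $\mathsf{Cand}$ and $\mathsf{Sol}$ are the sets of candidates and of solutions, and, at any point, $\mathsf{Pruned}$ is the set of all assignments satisfying some formula $\varphi$ for which a step $\Phi_{cur}:=\Phi_{cur}\wedge\neg\varphi$ has been performed so far. Properties (of the algorithm run with generalizer $g$): Property 2: for every terminated execution and every $\sigma\models\Phi$, $[\sigma]\cap\mathsf{Cand}$ has at most one element. Property 3 (invariant): in every execution, at every point, for every $\sigma$ for which the step $\Phi_{cur}:=\Phi_{cur}\wedge\neg g(\sigma)$ has been performed so far and every $\rho\simeq\sigma$, every assignment satisfying $g(\rho)$ belongs to $\mathsf{Pruned}$. *)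

theory Defs
  imports Main "HOL-Library.FuncSet"
begin

record ('l, 'q) lts =
  lts_labels :: "'l set"
  lts_states :: "'q set"
  lts_inits :: "'q set"
  lts_trans :: "('q \<times> 'l \<times> 'q) set"

definition wf_lts :: "('l, 'q) lts \<Rightarrow> bool" where
  "wf_lts M \<longleftrightarrow> finite (lts_labels M) \<and> finite (lts_states M)
     \<and> lts_inits M \<subseteq> lts_states M
     \<and> lts_trans M \<subseteq> lts_states M \<times> lts_labels M \<times> lts_states M"

datatype (vars: 'v) formula =
  Bot
| Var 'v
| Neg "'v formula"
| Conj "'v formula" "'v formula"
| Disj "'v formula" "'v formula"

primrec sat :: "('v \<Rightarrow> bool) \<Rightarrow> 'v formula \<Rightarrow> bool" (infix \<open>\<Turnstile>\<close> 50) where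
  "(\<sigma> \<Turnstile> Bot) = False"
| "(\<sigma> \<Turnstile> Var x) = \<sigma> x"
| "(\<sigma> \<Turnstile> Neg \<phi>) = (\<not> \<sigma> \<Turnstile> \<phi>)"
| "(\<sigma> \<Turnstile> Conj \<phi> \<chi>) = (\<sigma> \<Turnstile> \<phi> \<and> \<sigma> \<Turnstile> \<chi>)"
| "(\<sigma> \<Turnstile> Disj \<phi> \<chi>) = (\<sigma> \<Turnstile> \<phi> \<or> \<sigma> \<Turnstile> \<chi>)"

text \<open>Assignments to a set \<open>V\<close> of variables are extensional functions, so that two assignments
  are equal iff they agree on \<open>V\<close>.\<close>

definition assignments :: "'v set \<Rightarrow> ('v \<Rightarrow> bool) set" where
  "assignments V = (V \<rightarrow>\<^sub>E UNIV)"

definition sat_assignments :: "'v set \<Rightarrow> 'v formula \<Rightarrow> ('v \<Rightarrow> bool) set" where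
  "sat_assignments V \<phi> = {\<sigma> \<in> assignments V. \<sigma> \<Turnstile> \<phi>}"

text \<open>A formula over \<open>V\<close> satisfied by exactly the elements of \<open>S\<close>. It is determined only up to
  logical equivalence, and exists whenever \<open>V\<close> is finite (lemma \<open>formula_of\<close> below).\<close>

definition formula_of :: "'v set \<Rightarrow> ('v \<Rightarrow> bool) set \<Rightarrow> 'v formula" where
  "formula_of V S = (SOME \<phi>. vars \<phi> \<subseteq> V \<and> sat_assignments V \<phi> = S)"

lemma ex_formula_singleton:
  assumes "finite W" and "W \<subseteq> V"
  shows "\<exists>\<phi>. vars \<phi> \<subseteq> V \<and> (\<forall>\<tau>. \<tau> \<Turnstile> \<phi> \<longleftrightarrow> (\<forall>x\<in>W. \<tau> x = \<sigma> x))"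
  using assms
proof (induction W rule: finite_induct)
  case empty
  show ?case by (rule exI[of _ "Neg Bot"]) simp
next
  case (insert x W)
  then obtain \<phi> where "vars \<phi> \<subseteq> V" "\<forall>\<tau>. \<tau> \<Turnstile> \<phi> \<longleftrightarrow> (\<forall>x\<in>W. \<tau> x = \<sigma> x)" by auto
  then show ?case
    using insert.prems by (intro exI[of _ "Conj (if \<sigma> x then Var x else Neg (Var x)) \<phi>"]) auto
qed

lemma ex_formula:
  assumes "finite V" and "finite S" and "S \<subseteq> assignments V"
  shows "\<exists>\<phi>. vars \<phi> \<subseteq> V \<and> sat_assignments V \<phi> = S"
  using assms(2,3)
proof (induction S rule: finite_induct)
  case empty
  show ?case by (rule exI[of _ Bot]) (simp add: sat_assignments_def)
next
  case (insert \<sigma> S)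
  then obtain \<phi> where \<phi>: "vars \<phi> \<subseteq> V" "sat_assignments V \<phi> = S" by auto
  obtain \<chi> where \<chi>: "vars \<chi> \<subseteq> V" "\<forall>\<tau>. \<tau> \<Turnstile> \<chi> \<longleftrightarrow> (\<forall>x\<in>V. \<tau> x = \<sigma> x)"
    using ex_formula_singleton[OF assms(1) order_refl, of \<sigma>] by blast
  have "\<tau> \<Turnstile> \<chi> \<longleftrightarrow> \<tau> = \<sigma>" if "\<tau> \<in> assignments V" for \<tau>
  proof
    assume "\<tau> \<Turnstile> \<chi>"
    then have "\<tau> x = \<sigma> x" if "x \<in> V" for x using \<chi>(2) that by blast
    moreover have "\<sigma> \<in> assignments V" using insert.prems by blast
    ultimately show "\<tau> = \<sigma>" using \<open>\<tau> \<in> assignments V\<close> unfolding assignments_def by (intro PiE_ext)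
  qed (use \<chi>(2) in blast)
  then have "sat_assignments V (Disj \<chi> \<phi>) = insert \<sigma> S"
    using \<phi>(2) insert.prems by (auto simp: sat_assignments_def)
  then show ?case using \<phi>(1) \<chi>(1) by (intro exI[of _ "Disj \<chi> \<phi>"]) simp
qed

lemma formula_of:
  assumes "finite V" and "S \<subseteq> assignments V"
  shows "vars (formula_of V S) \<subseteq> V" and "sat_assignments V (formula_of V S) = S"
proof -
  have "finite S"
    using finite_subset[OF assms(2)] assms(1) by (simp add: assignments_def finite_PiE)
  then have "vars (formula_of V S) \<subseteq> V \<and> sat_assignments V (formula_of V S) = S"
    unfolding formula_of_def by (intro someI_ex[OF ex_formula] assms)
  then show "vars (formula_of V S) \<subseteq> V" and "sat_assignments V (formula_of V S) = S" by auto
qed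

text \<open>The Boolean variable \<open>x\<^bsub>p,a,q\<^esub>\<close> is represented by the triple \<open>(p, a, q)\<close> itself.\<close>

type_synonym ('l, 'q) var = "'q \<times> 'l \<times> 'q"
type_synonym ('l, 'q) assignment = "('l, 'q) var \<Rightarrow> bool"

definition lts_vars :: "('l, 'q) lts \<Rightarrow> ('l, 'q) var set" where
  "lts_vars M0 = lts_states M0 \<times> lts_labels M0 \<times> lts_states M0"

definition encoded_lts :: "('l, 'q) lts \<Rightarrow> ('l, 'q) assignment \<Rightarrow> ('l, 'q) lts" where
  "encoded_lts M0 \<sigma> = M0\<lparr>lts_trans := {t \<in> lts_vars M0. \<sigma> t}\<rparr>"

definition isolated_states :: "('l, 'q) lts \<Rightarrow> 'q set" where
  "isolated_states M0 = {q \<in> lts_states M0 - lts_inits M0.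
     \<forall>a r. (q, a, r) \<notin> lts_trans M0 \<and> (r, a, q) \<notin> lts_trans M0}"

definition iso_assignments :: "('l, 'q) lts \<Rightarrow> ('l, 'q) var formula
    \<Rightarrow> ('l, 'q) assignment \<Rightarrow> ('l, 'q) assignment \<Rightarrow> bool" where
  "iso_assignments M0 \<Phi> \<sigma> \<rho> \<longleftrightarrow>
     \<sigma> \<in> sat_assignments (lts_vars M0) \<Phi> \<and> \<rho> \<in> sat_assignments (lts_vars M0) \<Phi> \<and>
     (\<exists>f. bij_betw f (lts_states M0) (lts_states M0) \<and>
       (\<forall>q \<in> lts_states M0 - isolated_states M0. f q = q) \<and>
       (\<forall>p \<in> lts_states M0. \<forall>a \<in> lts_labels M0. \<forall>q \<in> lts_states M0.
          (p, a, q) \<in> lts_trans (encoded_lts M0 \<sigma>) \<longleftrightarrow>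
          (f p, a, f q) \<in> lts_trans (encoded_lts M0 \<rho>)))"

definition iso_class :: "('l, 'q) lts \<Rightarrow> ('l, 'q) var formula
    \<Rightarrow> ('l, 'q) assignment \<Rightarrow> ('l, 'q) assignment set" where
  "iso_class M0 \<Phi> \<rho> = {\<sigma> \<in> sat_assignments (lts_vars M0) \<Phi>. iso_assignments M0 \<Phi> \<sigma> \<rho>}"

type_synonym ('l, 'q) generalizer = "('l, 'q) assignment \<Rightarrow> ('l, 'q) var formula"

definition generalizer :: "('l, 'q) lts \<Rightarrow> ('l, 'q) generalizer \<Rightarrow> bool" where
  "generalizer M0 g \<longleftrightarrow> (\<forall>\<sigma> \<in> assignments (lts_vars M0). vars (g \<sigma>) \<subseteq> lts_vars M0)"

text \<open>In the following, \<open>models M \<psi>\<close> is the satisfaction relation between LTSs and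
  specifications; specifications are left abstract.\<close>

definition proper :: "('l, 'q) lts \<Rightarrow> ('l, 'q) var formula \<Rightarrow> (('l, 'q) lts \<Rightarrow> 's \<Rightarrow> bool) \<Rightarrow> 's
    \<Rightarrow> ('l, 'q) generalizer \<Rightarrow> bool" where
  "proper M0 \<Phi> models \<psi> \<gamma> \<longleftrightarrow>
     (\<forall>\<sigma> \<in> sat_assignments (lts_vars M0) \<Phi>. \<not> models (encoded_lts M0 \<sigma>) \<psi> \<longrightarrow>
        \<sigma> \<Turnstile> \<gamma> \<sigma> \<and>
        \<not> (\<exists>\<rho> \<in> sat_assignments (lts_vars M0) \<Phi>. models (encoded_lts M0 \<rho>) \<psi> \<and> \<rho> \<Turnstile> \<gamma> \<sigma>))"

text \<open>The state of the algorithm. Besides the current formula and the sets of candidates and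
  solutions, it records the set \<open>blocked\<close> of all formulas \<open>\<phi>\<close> for which the current formula has
  been conjoined with the negation of \<open>\<phi>\<close>, and the set \<open>generalized\<close> of all candidates \<open>\<sigma>\<close> for
  which this was done with the generalization of \<open>\<sigma>\<close>.\<close>

record ('l, 'q) gcg_state =
  cur :: "('l, 'q) var formula"
  cand :: "('l, 'q) assignment set"
  sol :: "('l, 'q) assignment set"
  blocked :: "('l, 'q) var formula set"
  generalized :: "('l, 'q) assignment set"

definition gcg_init :: "('l, 'q) var formula \<Rightarrow> ('l, 'q) gcg_state" where
  "gcg_init \<Phi> = \<lparr>cur = \<Phi>, cand = {}, sol = {}, blocked = {}, generalized = {}\<rparr>"

definition block :: "('l, 'q) var formula \<Rightarrow> ('l, 'q) gcg_state \<Rightarrow> ('l, 'q) gcg_state" where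
  "block \<phi> s = s\<lparr>cur := Conj (cur s) (Neg \<phi>), blocked := insert \<phi> (blocked s)\<rparr>"

inductive gcg_step :: "('l, 'q) lts \<Rightarrow> ('l, 'q) var formula \<Rightarrow> (('l, 'q) lts \<Rightarrow> 's \<Rightarrow> bool) \<Rightarrow> 's
    \<Rightarrow> ('l, 'q) generalizer \<Rightarrow> ('l, 'q) gcg_state \<Rightarrow> ('l, 'q) gcg_state \<Rightarrow> bool"
  for M0 \<Phi> models \<psi> g where
  solution:
    "\<sigma> \<in> sat_assignments (lts_vars M0) (cur s) \<Longrightarrow> models (encoded_lts M0 \<sigma>) \<psi> \<Longrightarrow>
     gcg_step M0 \<Phi> models \<psi> g s
       (block (formula_of (lts_vars M0) (iso_class M0 \<Phi> \<sigma>))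
         (s\<lparr>cand := insert \<sigma> (cand s), sol := insert \<sigma> (sol s)\<rparr>))"
| generalize:
    "\<sigma> \<in> sat_assignments (lts_vars M0) (cur s) \<Longrightarrow> \<not> models (encoded_lts M0 \<sigma>) \<psi> \<Longrightarrow>
     gcg_step M0 \<Phi> models \<psi> g s
       (block (g \<sigma>)
         (s\<lparr>cand := insert \<sigma> (cand s), generalized := insert \<sigma> (generalized s)\<rparr>))"

text \<open>The states occurring at some point of some (finite or infinite) execution.\<close>

definition gcg_reachable :: "('l, 'q) lts \<Rightarrow> ('l, 'q) var formula
    \<Rightarrow> (('l, 'q) lts \<Rightarrow> 's \<Rightarrow> bool) \<Rightarrow> 's \<Rightarrow> ('l, 'q) generalizer
    \<Rightarrow> ('l, 'q) gcg_state \<Rightarrow> bool" where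
  "gcg_reachable M0 \<Phi> models \<psi> g s \<longleftrightarrow> (gcg_step M0 \<Phi> models \<psi> g)\<^sup>*\<^sup>* (gcg_init \<Phi>) s"

definition terminated :: "('l, 'q) lts \<Rightarrow> ('l, 'q) gcg_state \<Rightarrow> bool" where
  "terminated M0 s \<longleftrightarrow> sat_assignments (lts_vars M0) (cur s) = {}"

definition pruned :: "('l, 'q) lts \<Rightarrow> ('l, 'q) gcg_state \<Rightarrow> ('l, 'q) assignment set" where
  "pruned M0 s = {\<tau> \<in> assignments (lts_vars M0). \<exists>\<phi> \<in> blocked s. \<tau> \<Turnstile> \<phi>}"

definition property2 :: "('l, 'q) lts \<Rightarrow> ('l, 'q) var formula
    \<Rightarrow> (('l, 'q) lts \<Rightarrow> 's \<Rightarrow> bool) \<Rightarrow> 's \<Rightarrow> ('l, 'q) generalizer \<Rightarrow> bool" where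
  "property2 M0 \<Phi> models \<psi> g \<longleftrightarrow>
     (\<forall>s. gcg_reachable M0 \<Phi> models \<psi> g s \<and> terminated M0 s \<longrightarrow>
       (\<forall>\<sigma> \<in> sat_assignments (lts_vars M0) \<Phi>.
          \<forall>\<tau> \<in> iso_class M0 \<Phi> \<sigma> \<inter> cand s. \<forall>\<tau>' \<in> iso_class M0 \<Phi> \<sigma> \<inter> cand s. \<tau> = \<tau>'))"

definition property3 :: "('l, 'q) lts \<Rightarrow> ('l, 'q) var formula
    \<Rightarrow> (('l, 'q) lts \<Rightarrow> 's \<Rightarrow> bool) \<Rightarrow> 's \<Rightarrow> ('l, 'q) generalizer \<Rightarrow> bool" where
  "property3 M0 \<Phi> models \<psi> g \<longleftrightarrow>
     (\<forall>s. gcg_reachable M0 \<Phi> models \<psi> g s \<longrightarrow>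
       (\<forall>\<sigma> \<in> generalized s. \<forall>\<rho>. iso_assignments M0 \<Phi> \<rho> \<sigma> \<longrightarrow>
          sat_assignments (lts_vars M0) (g \<rho>) \<subseteq> pruned M0 s))"

end

theory Submission
  imports Defs
begin

text \<open>By Property 3 and properness, or directly by the blocked class for a solution, every
  assignment isomorphic to a candidate is pruned. A new candidate is never pruned, so it is not
  isomorphic to an earlier one.\<close>

text \<open>The inverse of a witnessing bijection witnesses the converse relation.\<close>

lemma iso_assignments_sym:
  assumes "iso_assignments M0 \<Phi> \<sigma> \<rho>"
  shows "iso_assignments M0 \<Phi> \<rho> \<sigma>"
proof -
  let ?Q = "lts_states M0"
  let ?D = "\<lambda>\<sigma>. lts_trans (encoded_lts M0 \<sigma>)"
  obtain f where f: "bij_betw f ?Q ?Q" "\<forall>q \<in> ?Q - isolated_states M0. f q = q"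
    and tr: "\<forall>p \<in> ?Q. \<forall>a \<in> lts_labels M0. \<forall>q \<in> ?Q.
      (p, a, q) \<in> ?D \<sigma> \<longleftrightarrow> (f p, a, f q) \<in> ?D \<rho>"
    using assms unfolding iso_assignments_def by blast
  define g where "g = inv_into ?Q f"
  have g: "bij_betw g ?Q ?Q" unfolding g_def by (rule bij_betw_inv_into[OF f(1)])
  have fg: "f (g q) = q" if "q \<in> ?Q" for q
    unfolding g_def by (rule bij_betw_inv_into_right[OF f(1) that])
  have gQ: "g q \<in> ?Q" if "q \<in> ?Q" for q using g that by (rule bij_betwE[THEN bspec])
  \<comment> \<open>Since \<open>f\<close> fixes \<open>q\<close>, the state \<open>q\<close> is its
    own preimage under \<open>f\<close>.\<close>
  have "g q = q" if "q \<in> ?Q - isolated_states M0" for q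
    using bij_betw_inv_into_left[OF f(1), of q] f(2) that unfolding g_def by auto
  \<comment> \<open>This is \<open>tr\<close> read at the preimages \<open>g p\<close> and
    \<open>g q\<close>, where \<open>f\<close> cancels \<open>g\<close>.\<close>
  moreover have "(p, a, q) \<in> ?D \<rho> \<longleftrightarrow> (g p, a, g q) \<in> ?D \<sigma>"
    if "p \<in> ?Q" "a \<in> lts_labels M0" "q \<in> ?Q" for p a q
    using tr gQ fg that by simp
  ultimately show ?thesis
    using assms g unfolding iso_assignments_def by blast
qed

lemma iso_assignments_trans:
  assumes "iso_assignments M0 \<Phi> \<sigma> \<rho>" and "iso_assignments M0 \<Phi> \<rho> \<tau>"
  shows "iso_assignments M0 \<Phi> \<sigma> \<tau>"
proof -
  let ?Q = "lts_states M0"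
  let ?D = "\<lambda>\<sigma>. lts_trans (encoded_lts M0 \<sigma>)"
  obtain f where f: "bij_betw f ?Q ?Q" "\<forall>q \<in> ?Q - isolated_states M0. f q = q"
    "\<forall>p \<in> ?Q. \<forall>a \<in> lts_labels M0. \<forall>q \<in> ?Q. (p, a, q) \<in> ?D \<sigma> \<longleftrightarrow> (f p, a, f q) \<in> ?D \<rho>"
    using assms(1) unfolding iso_assignments_def by blast
  obtain g where g: "bij_betw g ?Q ?Q" "\<forall>q \<in> ?Q - isolated_states M0. g q = q"
    "\<forall>p \<in> ?Q. \<forall>a \<in> lts_labels M0. \<forall>q \<in> ?Q. (p, a, q) \<in> ?D \<rho> \<longleftrightarrow> (g p, a, g q) \<in> ?D \<tau>"
    using assms(2) unfolding iso_assignments_def by blast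
  have "bij_betw (g \<circ> f) ?Q ?Q" by (rule bij_betw_trans[OF f(1) g(1)])
  moreover have "\<forall>q \<in> ?Q - isolated_states M0. (g \<circ> f) q = q" using f(2) g(2) by simp
  moreover have "\<forall>p \<in> ?Q. \<forall>a \<in> lts_labels M0. \<forall>q \<in> ?Q.
      (p, a, q) \<in> ?D \<sigma> \<longleftrightarrow> ((g \<circ> f) p, a, (g \<circ> f) q) \<in> ?D \<tau>"
    using f(3) g(3) bij_betwE[OF f(1)] by simp
  ultimately show ?thesis
    using assms unfolding iso_assignments_def by blast
qed

text \<open>A well-formed LTS has finitely many variables, so the formula chosen by
  \<open>formula_of\<close> really defines the class, and \<rho> belongs to that class.\<close>

lemma sat_iso_class_formula:
  assumes "wf_lts M0" and "iso_assignments M0 \<Phi> \<rho> \<sigma>"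
  shows "\<rho> \<Turnstile> formula_of (lts_vars M0) (iso_class M0 \<Phi> \<sigma>)"
proof -
  have "finite (lts_vars M0)" using assms(1) by (simp add: wf_lts_def lts_vars_def)
  moreover have "iso_class M0 \<Phi> \<sigma> \<subseteq> assignments (lts_vars M0)"
    by (auto simp: iso_class_def sat_assignments_def)
  ultimately have "sat_assignments (lts_vars M0)
      (formula_of (lts_vars M0) (iso_class M0 \<Phi> \<sigma>)) = iso_class M0 \<Phi> \<sigma>"
    by (rule formula_of(2))
  moreover have "\<rho> \<in> iso_class M0 \<Phi> \<sigma>"
    using assms(2) by (auto simp: iso_class_def iso_assignments_def)
  ultimately show ?thesis by (auto simp: sat_assignments_def)
qed

text \<open>Besides the induction hypothesis, the step case provides reachability of the state
  before the step, so that Property 3 and other invariants can be applied there.\<close>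

lemma gcg_reachable_induct [consumes 1, case_names init step]:
  assumes "gcg_reachable M0 \<Phi> models \<psi> g s"
    and "P (gcg_init \<Phi>)"
    and "\<And>s s'. gcg_reachable M0 \<Phi> models \<psi> g s \<Longrightarrow> gcg_step M0 \<Phi> models \<psi> g s s'
      \<Longrightarrow> P s \<Longrightarrow> P s'"
  shows "P s"
proof -
  from assms(1) have "(gcg_step M0 \<Phi> models \<psi> g)\<^sup>*\<^sup>* (gcg_init \<Phi>) s"
    by (simp add: gcg_reachable_def)
  then show ?thesis
  proof (induction rule: rtranclp_induct)
    case base
    show ?case by (rule assms(2))
  next
    case (step s s')
    from step.hyps(1) have "gcg_reachable M0 \<Phi> models \<psi> g s" by (simp add: gcg_reachable_def)
    then show ?case using step.hyps(2) step.IH by (rule assms(3))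
  qed
qed

text \<open>Each step conjoins the negation of exactly the formula that it adds to
  \<open>blocked\<close>. Its use is that a newly picked candidate is never pruned.\<close>

lemma sat_cur_iff:
  assumes "gcg_reachable M0 \<Phi> models \<psi> g s"
  shows "\<tau> \<Turnstile> cur s \<longleftrightarrow> \<tau> \<Turnstile> \<Phi> \<and> (\<forall>\<phi> \<in> blocked s. \<not> \<tau> \<Turnstile> \<phi>)"
  using assms
proof (induction rule: gcg_reachable_induct)
  case init
  show ?case by (simp add: gcg_init_def)
next
  case (step s s')
  from step.hyps(2) step.IH show ?case by cases (auto simp: block_def)
qed

text \<open>The two disjuncts are the two kinds of step that can add \<open>c\<close>, and later
  steps only enlarge \<open>blocked\<close> and \<open>generalized\<close>. Failure of \<psi> is
  kept in the second disjunct because properness speaks only about assignments that violate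
  \<psi>.\<close>

lemma cand_blocked_or_generalized:
  assumes "gcg_reachable M0 \<Phi> models \<psi> g s" and "c \<in> cand s"
  shows "formula_of (lts_vars M0) (iso_class M0 \<Phi> c) \<in> blocked s
    \<or> c \<in> generalized s \<and> \<not> models (encoded_lts M0 c) \<psi>"
  using assms
proof (induction rule: gcg_reachable_induct)
  case init
  then show ?case by (simp add: gcg_init_def)
next
  case (step s s')
  from step.hyps(2) step.prems step.IH show ?case by cases (auto simp: block_def)
qed

lemma iso_cand_pruned:
  assumes "wf_lts M0"
    and inv: "\<forall>\<sigma> \<rho>. iso_assignments M0 \<Phi> \<sigma> \<rho> \<longrightarrow>
           (models (encoded_lts M0 \<sigma>) \<psi> \<longleftrightarrow> models (encoded_lts M0 \<rho>) \<psi>)"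
    and "proper M0 \<Phi> models \<psi> \<gamma>"
    and "property3 M0 \<Phi> models \<psi> \<gamma>"
    and s: "gcg_reachable M0 \<Phi> models \<psi> \<gamma> s"
    and "c \<in> cand s" and iso: "iso_assignments M0 \<Phi> \<rho> c"
  shows "\<rho> \<in> pruned M0 s"
proof -
  have \<rho>: "\<rho> \<in> sat_assignments (lts_vars M0) \<Phi>" using iso by (simp add: iso_assignments_def)
  then have \<rho>V: "\<rho> \<in> assignments (lts_vars M0)" by (simp add: sat_assignments_def)
  from cand_blocked_or_generalized[OF s \<open>c \<in> cand s\<close>] show ?thesis
  proof (elim disjE conjE)
    assume "formula_of (lts_vars M0) (iso_class M0 \<Phi> c) \<in> blocked s"
    then show ?thesis
      using sat_iso_class_formula[OF assms(1) iso] \<rho>V by (auto simp: pruned_def)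
  next
    assume c: "c \<in> generalized s" "\<not> models (encoded_lts M0 c) \<psi>"
    \<comment> \<open>Property 3 prunes the models of \<open>\<gamma> \<rho>\<close>, so properness
      has to be applied at \<rho> itself rather than at \<open>c\<close>; invariance of \<psi> under
      isomorphism transfers the violation from \<open>c\<close> to \<rho>.\<close>
    then have "\<not> models (encoded_lts M0 \<rho>) \<psi>" using inv iso by blast
    then have "\<rho> \<Turnstile> \<gamma> \<rho>" using \<open>proper M0 \<Phi> models \<psi> \<gamma>\<close> \<rho> by (simp add: proper_def)
    then have "\<rho> \<in> sat_assignments (lts_vars M0) (\<gamma> \<rho>)" using \<rho>V by (simp add: sat_assignments_def)
    then show ?thesis
      using \<open>property3 M0 \<Phi> models \<psi> \<gamma>\<close> s c(1) iso unfolding property3_def by blast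
  qed
qed

text \<open>The set \<open>cand s\<close> forgets the order in which candidates were picked.
  Induction along the execution recovers it: each step compares one new candidate with the earlier
  ones.\<close>

lemma iso_cand_eq:
  assumes "wf_lts M0"
    and "\<forall>\<sigma> \<rho>. iso_assignments M0 \<Phi> \<sigma> \<rho> \<longrightarrow>
           (models (encoded_lts M0 \<sigma>) \<psi> \<longleftrightarrow> models (encoded_lts M0 \<rho>) \<psi>)"
    and "proper M0 \<Phi> models \<psi> \<gamma>"
    and "property3 M0 \<Phi> models \<psi> \<gamma>"
    and "gcg_reachable M0 \<Phi> models \<psi> \<gamma> s"
    and "c \<in> cand s" and "d \<in> cand s" and "iso_assignments M0 \<Phi> c d"
  shows "c = d"
  using assms(5-8)
proof (induction arbitrary: c d rule: gcg_reachable_induct)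
  case init
  then show ?case by (simp add: gcg_init_def)
next
  case (step s s')
  from step.hyps(2) obtain \<sigma>
    where "\<sigma> \<in> sat_assignments (lts_vars M0) (cur s)" and cand: "cand s' = insert \<sigma> (cand s)"
    by cases (auto simp: block_def)
  \<comment> \<open>Satisfying \<open>cur s\<close> rules out every blocked formula.\<close>
  then have "\<sigma> \<notin> pruned M0 s"
    using sat_cur_iff[OF step.hyps(1)] by (auto simp: sat_assignments_def pruned_def)
  then have "\<not> iso_assignments M0 \<Phi> \<sigma> e" if "e \<in> cand s" for e
    using iso_cand_pruned[OF assms(1-4) step.hyps(1) that] by blast
  \<comment> \<open>Either of \<open>c\<close> and \<open>d\<close> may be the new candidate, so
    both directions are excluded. What remains is two old candidates, settled by the induction
    hypothesis, or twice the new one.\<close>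
  then have "\<not> iso_assignments M0 \<Phi> \<sigma> e \<and> \<not> iso_assignments M0 \<Phi> e \<sigma>" if "e \<in> cand s" for e
    using that iso_assignments_sym by meson
  then show ?case
    using step.IH[of c d] step.prems unfolding cand by auto
qed

theorem theorem2:
  fixes M0 :: "('l, 'q) lts"
    and \<Phi> :: "('l, 'q) var formula"
    and models :: "('l, 'q) lts \<Rightarrow> 's \<Rightarrow> bool"
    and \<psi> :: 's
    and \<gamma> :: "('l, 'q) generalizer"
  assumes "wf_lts M0"
    and "vars \<Phi> \<subseteq> lts_vars M0"
    and "\<forall>\<sigma> \<in> sat_assignments (lts_vars M0) \<Phi>. \<forall>t \<in> lts_trans M0. \<sigma> \<Turnstile> Var t"
    and "\<forall>\<sigma> \<rho>. iso_assignments M0 \<Phi> \<sigma> \<rho> \<longrightarrow>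
           (models (encoded_lts M0 \<sigma>) \<psi> \<longleftrightarrow> models (encoded_lts M0 \<rho>) \<psi>)"
    and "generalizer M0 \<gamma>"
    and "proper M0 \<Phi> models \<psi> \<gamma>"
    and "property3 M0 \<Phi> models \<psi> \<gamma>"
  shows "property2 M0 \<Phi> models \<psi> \<gamma>"
  unfolding property2_def
proof (intro allI impI ballI)
  fix s \<sigma> \<tau> \<tau>'
  assume "gcg_reachable M0 \<Phi> models \<psi> \<gamma> s \<and> terminated M0 s"
    and "\<tau> \<in> iso_class M0 \<Phi> \<sigma> \<inter> cand s" and "\<tau>' \<in> iso_class M0 \<Phi> \<sigma> \<inter> cand s"
  then have "gcg_reachable M0 \<Phi> models \<psi> \<gamma> s" "\<tau> \<in> cand s" "\<tau>' \<in> cand s"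
    and "iso_assignments M0 \<Phi> \<tau> \<sigma>" "iso_assignments M0 \<Phi> \<tau>' \<sigma>"
    by (auto simp: iso_class_def)
  \<comment> \<open>Both candidates are isomorphic to the representative \<sigma>, hence to each
    other through it.\<close>
  moreover from this(4,5) have "iso_assignments M0 \<Phi> \<tau> \<tau>'"
    by (rule iso_assignments_trans[OF _ iso_assignments_sym])
  ultimately show "\<tau> = \<tau>'"
    by (intro iso_cand_eq[OF assms(1,4,6,7)])
qed

end
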